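(* Let $n\ge1$. For $u=x_{F_1}^{a_1}\cdots x_{F_\ell}^{a_\ell}\in FY(\mathsf{B}_n)$ define $\phi(u)=(\alpha_1\cdots\alpha_n,f)$ by $$\alpha_i=\begin{cases} j & \text{if } i\in F_j\setminus F_{j-1}\\ 0 & \text{if } i\in[n]\setminus F_\ell\end{cases}\quad (i\in[n]),\qquad f(j)=a_j\quad (j\in[\ell]).$$ Then $\phi: FY(\mathsf{B}_n)\to \mathtt{Code}_n$ is a bijection that satisfies $\deg(u)=\mathrm{ind}(\phi(u))$ and respects the $\mathfrak{S}_n$-actions on both sets, i.e. $\phi(\sigma\cdot u)=\sigma\cdot\phi(u)$ for all $\sigma\in\mathfrak{S}_n$.
   Context: Write $[n]=\{1,\dots,n\}$. $FY(\mathsf{B}_n)$ is the set of formal monomials $x_{F_1}^{a_1}\cdots x_{F_\ell}^{a_\ell}$ with $0\le \ell\le n$, $\emptyset=F_0\subsetneq F_1\subsetneq\cdots\subsetneq F_\ell\subseteq[n]$ and $1\le a_i\le|F_i|-|F_{i-1}|-1$ for all $1\le i\le \ell$ (the case $\ell=0$ is the monomial $1$). The degree is $\deg(u)=a_1+\cdots+a_\ell$. $\mathfrak{S}_n$ acts on $FY(\mathsf{B}_n)$ by $\sigma\cdot x_{F_1}^{a_1}\cdots x_{F_\ell}^{a_\ell}=x_{\sigma(F_1)}^{a_1}\cdots x_{\sigma(F_\ell)}^{a_\ell}$. A Stembridge code of length $n$ is a pair $(\alpha,f)$ where $\alpha=\alpha_1\cdots\alpha_n$ is a sequence over $\{0,1,2,\dots\}$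 such that, with $m(\alpha)$ the maximum number appearing in $\alpha$, each $k\in\{1,\dots,m(\alpha)\}$ occurs at least twice in $\alpha$; and $f$ records a mark: for each such $k$, exactly one occurrence of $k$ that is not the first is marked, and $f(k)\ge1$ is the number of occurrences of $k$ to the left of the marked one (so $f:\{1,\dots,m(\alpha)\}\to\mathbb{Z}$ with $1\le f(k)\le(\text{number of occurrences of }k)-1$). The letter $0$ may occur any number of times. The index is $\mathrm{ind}(\alpha,f)=\sum_{k=1}^{m(\alpha)}f(k)$. $\mathtt{Code}_n$ is the set of all Stembridge codes of length $n$; $\mathfrak{S}_n$ acts on it by $\sigma\cdot(\alpha_1\cdots\alpha_n,f)=(\alpha_{\sigma^{-1}(1)}\cdots\alpha_{\sigma^{-1}(n)},f)$. *)

theory Defs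
  imports Main "HOL-Library.Multiset" "HOL-Library.FuncSet" "HOL-Combinatorics.Permutations"
begin

text \<open>
  A formal monomial in commuting variables indexed by subsets of the natural numbers is an element
  of the free commutative monoid on these subsets, i.e. a multiset: the power of the variable
  indexed by \<open>F\<close> with exponent \<open>a\<close> is \<open>replicate_mset a F\<close> and the product is the multiset sum.
\<close>

type_synonym monomial = "nat set multiset"

text \<open>
  Only \<open>F 0, ..., F l\<close> and \<open>a 1, ..., a l\<close> are meaningful. The differences of cardinalities
  are not truncated, since \<open>F (i - 1)\<close> is a proper subset of the finite set \<open>F i\<close>.
\<close>

definition fy_chain :: "nat \<Rightarrow> nat \<Rightarrow> (nat \<Rightarrow> nat set) \<Rightarrow> (nat \<Rightarrow> nat) \<Rightarrow> bool" where
  "fy_chain n l F a \<longleftrightarrow>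
     l \<le> n \<and> F 0 = {} \<and> (\<forall>i\<in>{1..l}. F (i - 1) \<subset> F i) \<and> F l \<subseteq> {1..n} \<and>
     (\<forall>i\<in>{1..l}. 1 \<le> a i \<and> a i \<le> card (F i) - card (F (i - 1)) - 1)"

definition fy_monomial :: "nat \<Rightarrow> (nat \<Rightarrow> nat set) \<Rightarrow> (nat \<Rightarrow> nat) \<Rightarrow> monomial" where
  "fy_monomial l F a = (\<Sum>i = 1..l. replicate_mset (a i) (F i))"

definition FY :: "nat \<Rightarrow> monomial set" where
  "FY n = {fy_monomial l F a | l F a. fy_chain n l F a}"

definition fy_deg :: "monomial \<Rightarrow> nat" where
  "fy_deg u = size u"

definition fy_act :: "(nat \<Rightarrow> nat) \<Rightarrow> monomial \<Rightarrow> monomial" where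
  "fy_act \<sigma> u = image_mset (\<lambda>F. \<sigma> ` F) u"

text \<open>
  A word of length \<open>n\<close> is an extensional function on \<open>{1..n}\<close>; the marks of a code are encoded by
  an extensional function on \<open>{1..m}\<close>, where \<open>m\<close> is the maximal letter (a mark function has
  positive values, so natural numbers suffice). Extensionality (the value is \<open>undefined\<close> outside the
  domain) makes equality of codes the intended one.
\<close>

type_synonym code = "(nat \<Rightarrow> nat) \<times> (nat \<Rightarrow> nat)"

definition max_letter :: "nat \<Rightarrow> (nat \<Rightarrow> nat) \<Rightarrow> nat" where
  "max_letter n \<alpha> = Max (\<alpha> ` {1..n})"

definition occurrences :: "nat \<Rightarrow> (nat \<Rightarrow> nat) \<Rightarrow> nat \<Rightarrow> nat" where
  "occurrences n \<alpha> k = card {i \<in> {1..n}. \<alpha> i = k}"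

definition Code :: "nat \<Rightarrow> code set" where
  "Code n = {(\<alpha>, f).
     \<alpha> \<in> {1..n} \<rightarrow>\<^sub>E UNIV \<and>
     (\<forall>k\<in>{1..max_letter n \<alpha>}. 2 \<le> occurrences n \<alpha> k) \<and>
     f \<in> (\<Pi>\<^sub>E k\<in>{1..max_letter n \<alpha>}. {1..occurrences n \<alpha> k - 1})}"

definition code_ind :: "nat \<Rightarrow> code \<Rightarrow> nat" where
  "code_ind n c = (\<Sum>k = 1..max_letter n (fst c). snd c k)"

definition code_act :: "nat \<Rightarrow> (nat \<Rightarrow> nat) \<Rightarrow> code \<Rightarrow> code" where
  "code_act n \<sigma> c = ((\<lambda>i\<in>{1..n}. fst c (inv \<sigma> i)), snd c)"

definition chain_code :: "nat \<Rightarrow> nat \<Rightarrow> (nat \<Rightarrow> nat set) \<Rightarrow> (nat \<Rightarrow> nat) \<Rightarrow> code" where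
  "chain_code n l F a =
     ((\<lambda>i\<in>{1..n}. if i \<in> F l then THE j. j \<in> {1..l} \<and> i \<in> F j - F (j - 1) else 0),
      (\<lambda>j\<in>{1..l}. a j))"

text \<open>
  The description in \<open>\<phi>\<close> is a proper one: a monomial determines its chain and exponents, see
  \<open>phi_fy_monomial\<close> below.
\<close>

definition \<phi> :: "nat \<Rightarrow> monomial \<Rightarrow> code" where
  "\<phi> n u = (THE c. \<exists>l F a. fy_chain n l F a \<and> u = fy_monomial l F a \<and> c = chain_code n l F a)"

lemma fy_chain_step:
  assumes "fy_chain n l F a" "m < l"
  shows "F m \<subset> F (Suc m)"
proof -
  have "\<forall>i\<in>{1..l}. F (i - 1) \<subset> F i"
    using assms(1) unfolding fy_chain_def by blast
  from bspec[OF this, of "Suc m"] assms(2) show ?thesis by simp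
qed

lemma fy_chain_mono:
  assumes "fy_chain n l F a" "i \<le> j" "j \<le> l"
  shows "F i \<subseteq> F j"
  using assms(2,3)
proof (induction j rule: dec_induct)
  case base
  show ?case by (rule subset_refl)
next
  case (step m)
  then have "F i \<subseteq> F m" "F m \<subset> F (Suc m)"
    using fy_chain_step[OF assms(1)] by simp_all
  then show ?case by blast
qed

lemma fy_chain_strict:
  assumes "fy_chain n l F a" "i < j" "j \<le> l"
  shows "F i \<subset> F j"
proof -
  have "F i \<subset> F (Suc i)" "F (Suc i) \<subseteq> F j"
    using fy_chain_step[OF assms(1), of i] fy_chain_mono[OF assms(1), of "Suc i" j] assms(2,3)
    by simp_all
  then show ?thesis by blast
qed

lemma fy_chain_subset_iff:
  assumes "fy_chain n l F a" "i \<le> l" "j \<le> l"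
  shows "F i \<subseteq> F j \<longleftrightarrow> i \<le> j"
proof (cases "i \<le> j")
  case True
  with fy_chain_mono[OF assms(1) True assms(3)] show ?thesis by simp
next
  case False
  with fy_chain_strict[OF assms(1), of j i] assms(2) show ?thesis by auto
qed

lemma fy_chain_eq_iff:
  assumes "fy_chain n l F a" "i \<le> l" "j \<le> l"
  shows "F i = F j \<longleftrightarrow> i = j"
  unfolding set_eq_subset fy_chain_subset_iff[OF assms] fy_chain_subset_iff[OF assms(1,3,2)]
  by (simp add: eq_iff)

lemma count_fy_monomial:
  assumes "fy_chain n l F a" "j \<in> {1..l}"
  shows "count (fy_monomial l F a) (F j) = a j"
proof -
  have "count (fy_monomial l F a) (F j) = (\<Sum>i = 1..l. if i = j then a i else 0)"
    unfolding fy_monomial_def count_sum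
  proof (rule sum.cong)
    fix i assume "i \<in> {1..l}"
    then show "count (replicate_mset (a i) (F i)) (F j) = (if i = j then a i else 0)"
      using fy_chain_eq_iff[OF assms(1), of j i] assms(2) by auto
  qed simp
  with assms(2) show ?thesis by simp
qed

lemma set_mset_fy_monomial:
  assumes "fy_chain n l F a"
  shows "set_mset (fy_monomial l F a) = F ` {1..l}"
proof -
  have "set_mset (fy_monomial l F a) = (\<Union>i\<in>{1..l}. set_mset (replicate_mset (a i) (F i)))"
    unfolding fy_monomial_def by (simp add: set_mset_sum)
  also have "\<dots> = (\<Union>i\<in>{1..l}. {F i})"
  proof (rule SUP_cong)
    fix i assume "i \<in> {1..l}"
    then have "a i \<noteq> 0" using assms unfolding fy_chain_def by fastforce
    then show "set_mset (replicate_mset (a i) (F i)) = {F i}" by simp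
  qed simp
  finally show ?thesis by auto
qed

lemma card_below_fy_chain:
  assumes "fy_chain n l F a" "j \<in> {1..l}"
  shows "card {G \<in> F ` {1..l}. G \<subseteq> F j} = j"
proof -
  have "F i \<subseteq> F j \<longleftrightarrow> i \<le> j" if "i \<in> {1..l}" for i
    using fy_chain_subset_iff[OF assms(1), of i j] assms(2) that by simp
  then have "{i \<in> {1..l}. F i \<subseteq> F j} = {i \<in> {1..l}. i \<le> j}"
    by blast
  also have "\<dots> = {1..j}"
    using assms(2) by auto
  finally have "{i \<in> {1..l}. F i \<subseteq> F j} = {1..j}" .
  moreover have "{G \<in> F ` {1..l}. G \<subseteq> F j} = F ` {i \<in> {1..l}. F i \<subseteq> F j}"
    by blast
  ultimately have "{G \<in> F ` {1..l}. G \<subseteq> F j} = F ` {1..j}"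
    by simp
  moreover have "inj_on F {1..j}"
    using assms(2) fy_chain_eq_iff[OF assms(1)] by (intro inj_onI) simp
  ultimately show ?thesis by (simp add: card_image)
qed

lemma fy_chain_unique:
  assumes 1: "fy_chain n l F a" and 2: "fy_chain n l' F' a'"
    and eq: "fy_monomial l F a = fy_monomial l' F' a'"
  shows "l = l'" "\<And>j. j \<le> l \<Longrightarrow> F j = F' j" "\<And>j. j \<in> {1..l} \<Longrightarrow> a j = a' j"
proof -
  have S: "F ` {1..l} = F' ` {1..l'}"
    using set_mset_fy_monomial[OF 1] set_mset_fy_monomial[OF 2] eq by simp
  have "inj_on F {1..l}" "inj_on F' {1..l'}"
    using fy_chain_eq_iff[OF 1] fy_chain_eq_iff[OF 2] by (intro inj_onI; simp)+
  from this[THEN card_image] S show l: "l = l'" by simp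
  have F: "F j = F' j" if "j \<in> {1..l}" for j
  proof -
    from that S obtain k where k: "k \<in> {1..l'}" "F j = F' k" by blast
    have "j = k"
      using card_below_fy_chain[OF 1 that] card_below_fy_chain[OF 2 k(1)] S k(2) by simp
    with k show ?thesis by simp
  qed
  show "F j = F' j" if "j \<le> l" for j
  proof (cases "j = 0")
    case True
    have "F 0 = {}" "F' 0 = {}" using 1 2 unfolding fy_chain_def by blast+
    with True show ?thesis by simp
  next
    case False
    with that show ?thesis by (intro F) simp
  qed
  show "a j = a' j" if "j \<in> {1..l}" for j
    using count_fy_monomial[OF 1 that] count_fy_monomial[OF 2, of j] F[OF that] that l eq by simp
qed

lemma chain_code_cong:
  assumes "\<And>j. j \<le> l \<Longrightarrow> F j = F' j" "\<And>j. j \<in> {1..l} \<Longrightarrow> a j = a' j"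
  shows "chain_code n l F a = chain_code n l F' a'"
proof -
  have "(\<lambda>j. j \<in> {1..l} \<and> i \<in> F j - F (j - 1)) = (\<lambda>j. j \<in> {1..l} \<and> i \<in> F' j - F' (j - 1))" for i
    using assms(1) by (intro ext) auto
  then show ?thesis
    using assms unfolding chain_code_def by (auto simp: restrict_def fun_eq_iff)
qed

lemma phi_fy_monomial:
  assumes "fy_chain n l F a"
  shows "\<phi> n (fy_monomial l F a) = chain_code n l F a"
  unfolding \<phi>_def
proof (rule the_equality)
  fix c
  assume "\<exists>l' F' a'. fy_chain n l' F' a' \<and> fy_monomial l F a = fy_monomial l' F' a' \<and>
            c = chain_code n l' F' a'"
  then obtain l' F' a' where *: "fy_chain n l' F' a'"
      "fy_monomial l F a = fy_monomial l' F' a'" "c = chain_code n l' F' a'"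
    by blast
  note u = fy_chain_unique[OF assms *(1,2)]
  from u(2,3) have "chain_code n l F a = chain_code n l F' a'"
    by (rule chain_code_cong)
  with u(1) *(3) show "c = chain_code n l F a" by simp
qed (use assms in blast)

lemma fy_chain_THE:
  assumes "fy_chain n l F a" "j \<in> {1..l}" "i \<in> F j - F (j - 1)"
  shows "(THE j. j \<in> {1..l} \<and> i \<in> F j - F (j - 1)) = j"
proof (rule the_equality)
  fix k assume k: "k \<in> {1..l} \<and> i \<in> F k - F (k - 1)"
  show "k = j"
  proof (rule linorder_cases[of k j])
    assume "k < j"
    then have "F k \<subseteq> F (j - 1)" using assms(2) by (intro fy_chain_mono[OF assms(1)]) auto
    with k assms(3) show ?thesis by auto
  next
    assume "j < k"
    then have "F j \<subseteq> F (k - 1)" using k by (intro fy_chain_mono[OF assms(1)]) auto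
    with k assms(3) show ?thesis by auto
  qed
qed (use assms in auto)

lemma chain_code_apply:
  assumes "fy_chain n l F a" "i \<in> {1..n}"
  shows "j \<in> {1..l} \<Longrightarrow> i \<in> F j - F (j - 1) \<Longrightarrow> fst (chain_code n l F a) i = j"
    and "i \<notin> F l \<Longrightarrow> fst (chain_code n l F a) i = 0"
proof -
  assume j: "j \<in> {1..l}" "i \<in> F j - F (j - 1)"
  have "i \<in> F l" using fy_chain_mono[OF assms(1), of j l] j by auto
  with fy_chain_THE[OF assms(1) j] assms(2) show "fst (chain_code n l F a) i = j"
    unfolding chain_code_def by simp
next
  assume "i \<notin> F l"
  with assms(2) show "fst (chain_code n l F a) i = 0"
    unfolding chain_code_def by simp
qed

lemma fy_deg_fy_monomial: "fy_deg (fy_monomial l F a) = (\<Sum>i = 1..l. a i)"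
  by (simp add: fy_deg_def fy_monomial_def size_multiset_sum)

lemma fy_act_fy_monomial:
  "fy_act \<sigma> (fy_monomial l F a) = fy_monomial l (\<lambda>i. \<sigma> ` F i) a"
proof -
  have "image_mset g (sum h A) = (\<Sum>x\<in>A. image_mset g (h x))"
    for g :: "nat set \<Rightarrow> nat set" and h and A :: "nat set"
    by (induction A rule: infinite_finite_induct) auto
  then show ?thesis by (simp add: fy_act_def fy_monomial_def)
qed

end

theory Submission
  imports Defs
begin

text \<open>
  The chain is recovered from the word of its code: \<open>F j\<close> consists of the positions carrying a
  letter in \<open>{1..j}\<close>, so the letter \<open>j\<close> occurs exactly \<open>card (F j) - card (F (j - 1))\<close> times and the
  bounds on the exponents of a monomial are the bounds on the marks of a code.
\<close>

section \<open>Level sets of a word\<close>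

definition level_set :: "nat \<Rightarrow> (nat \<Rightarrow> nat) \<Rightarrow> nat \<Rightarrow> nat set" where
  "level_set n \<alpha> j = {i \<in> {1..n}. 1 \<le> \<alpha> i \<and> \<alpha> i \<le> j}"

text \<open>The candidate for the inverse of \<open>\<phi> n\<close>, with the maximal letter as the
  length of the chain.\<close>

definition code_monomial :: "nat \<Rightarrow> code \<Rightarrow> monomial" where
  "code_monomial n c = fy_monomial (max_letter n (fst c)) (level_set n (fst c)) (snd c)"

lemma level_set_0: "level_set n \<alpha> 0 = {}"
  by (auto simp: level_set_def)

lemma level_set_diff:
  assumes "j \<ge> 1"
  shows "level_set n \<alpha> j - level_set n \<alpha> (j - 1) = {i \<in> {1..n}. \<alpha> i = j}"
  using assms by (auto simp: level_set_def)

lemma card_level_set_diff: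
  assumes "j \<ge> 1"
  shows "card (level_set n \<alpha> j) - card (level_set n \<alpha> (j - 1)) = occurrences n \<alpha> j"
proof -
  have "finite (level_set n \<alpha> (j - 1))" "level_set n \<alpha> (j - 1) \<subseteq> level_set n \<alpha> j"
    by (auto simp: level_set_def)
  from card_Diff_subset[OF this] level_set_diff[OF assms]
  show ?thesis by (simp add: occurrences_def)
qed

section \<open>The code of a chain\<close>

lemma fy_chain_subset:
  assumes "fy_chain n l F a" "j \<le> l"
  shows "F j \<subseteq> {1..n}"
  using fy_chain_mono[OF assms order_refl] assms(1) unfolding fy_chain_def by blast

lemma fy_chain_obtain_step:
  assumes "fy_chain n l F a" "j \<le> l" "i \<in> F j"
  obtains k where "k \<in> {1..j}" "i \<in> F k - F (k - 1)"
proof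
  \<comment> \<open>By minimality \<open>i\<close> enters the chain exactly at step
    \<open>k\<close>; \<open>F 0 = {}\<close> forces \<open>k\<close> to be positive, so
    \<open>k - 1\<close> is a genuine predecessor.\<close>
  define k where "k = (LEAST k. i \<in> F k)"
  have k: "i \<in> F k" "k \<le> j"
    unfolding k_def using assms(3) by (auto intro: LeastI Least_le)
  have "k \<noteq> 0" using k assms(1) unfolding fy_chain_def by (intro notI) simp
  then have "i \<notin> F (k - 1)"
    unfolding k_def by (intro not_less_Least) simp
  with k show "i \<in> F k - F (k - 1)" by simp
  from k \<open>k \<noteq> 0\<close> show "k \<in> {1..j}" by simp
qed

lemma chain_code_le:
  assumes "fy_chain n l F a" "i \<in> {1..n}"
  shows "fst (chain_code n l F a) i \<le> l"
proof (cases "i \<in> F l")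
  case True
  then obtain k where "k \<in> {1..l}" "i \<in> F k - F (k - 1)"
    using fy_chain_obtain_step[OF assms(1)] by blast
  with chain_code_apply(1)[OF assms] show ?thesis by simp
next
  case False
  with chain_code_apply(2)[OF assms] show ?thesis by simp
qed

text \<open>A position lies in \<open>F j\<close> exactly when the step at which it enters the chain
  is at most \<open>j\<close>, and that step is its letter. Hence the word determines the
  chain.\<close>

lemma level_set_chain_code:
  assumes "fy_chain n l F a" "j \<le> l"
  shows "level_set n (fst (chain_code n l F a)) j = F j"
proof (rule set_eqI, rule iffI)
  fix i assume "i \<in> F j"
  then obtain k where k: "k \<in> {1..j}" "i \<in> F k - F (k - 1)"
    using fy_chain_obtain_step[OF assms] by blast
  have i: "i \<in> {1..n}" using \<open>i \<in> F j\<close> fy_chain_subset[OF assms] by blast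
  have "fst (chain_code n l F a) i = k"
    using chain_code_apply(1)[OF assms(1) i] k assms(2) by simp
  with i k show "i \<in> level_set n (fst (chain_code n l F a)) j"
    by (simp add: level_set_def)
next
  fix i assume "i \<in> level_set n (fst (chain_code n l F a)) j"
  then have i: "i \<in> {1..n}" and le: "1 \<le> fst (chain_code n l F a) i" "fst (chain_code n l F a) i \<le> j"
    by (auto simp: level_set_def)
  have "i \<in> F l"
    using chain_code_apply(2)[OF assms(1) i] le(1) by fastforce
  then obtain k where k: "k \<in> {1..l}" "i \<in> F k - F (k - 1)"
    using fy_chain_obtain_step[OF assms(1)] by blast
  then have "k \<le> j" using chain_code_apply(1)[OF assms(1) i k] le(2) by simp
  with k fy_chain_mono[OF assms(1) _ assms(2)] show "i \<in> F j" by blast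
qed

text \<open>The last step of the chain is nonempty, so the letter \<open>l\<close> is attained. For
  \<open>l = 0\<close> the word is constantly 0, and \<open>n \<ge> 1\<close> supplies a position,
  so \<open>Max\<close> is not taken over the empty set.\<close>

lemma max_letter_chain_code:
  assumes "fy_chain n l F a" "n \<ge> 1"
  shows "max_letter n (fst (chain_code n l F a)) = l"
  unfolding max_letter_def
proof (rule Max_eqI)
  fix y assume "y \<in> fst (chain_code n l F a) ` {1..n}"
  then show "y \<le> l" using chain_code_le[OF assms(1)] by blast
next
  show "l \<in> fst (chain_code n l F a) ` {1..n}"
  proof (cases "l = 0")
    case True
    have "fst (chain_code n l F a) 1 \<le> 0"
      using chain_code_le[OF assms(1), of 1] assms(2) True by simp
    with True assms(2) show ?thesis by (intro image_eqI[of _ _ 1]) auto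
  next
    case False
    then obtain i where i: "i \<in> F l - F (l - 1)"
      using fy_chain_strict[OF assms(1), of "l - 1" l] by auto
    then have "i \<in> {1..n}" using fy_chain_subset[OF assms(1)] by blast
    with chain_code_apply(1)[OF assms(1) this, of l] i False show ?thesis by force
  qed
qed simp

lemma chain_code_in_Code:
  assumes "fy_chain n l F a" "n \<ge> 1"
  shows "chain_code n l F a \<in> Code n"
proof -
  let ?\<alpha> = "fst (chain_code n l F a)"
  have "1 \<le> a k \<and> a k \<le> occurrences n ?\<alpha> k - 1" if "k \<in> {1..l}" for k
  proof -
    have "card (F k) - card (F (k - 1)) = occurrences n ?\<alpha> k"
      using card_level_set_diff[of k n ?\<alpha>] level_set_chain_code[OF assms(1), of k]
        level_set_chain_code[OF assms(1), of "k - 1"] that by fastforce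
    with assms(1) that show ?thesis unfolding fy_chain_def by metis
  qed
  note marks = this
  \<comment> \<open>The existence of an exponent between 1 and
    \<open>occurrences n ?\<alpha> k - 1\<close> already forces two occurrences.\<close>
  have "2 \<le> occurrences n ?\<alpha> k" if "k \<in> {1..l}" for k
    using marks[OF that] by linarith
  moreover have "snd (chain_code n l F a) \<in> (\<Pi>\<^sub>E k\<in>{1..l}. {1..occurrences n ?\<alpha> k - 1})"
    using marks by (simp add: chain_code_def PiE_iff)
  moreover have "?\<alpha> \<in> {1..n} \<rightarrow>\<^sub>E UNIV"
    by (simp add: chain_code_def)
  ultimately show ?thesis
    using max_letter_chain_code[OF assms] by (simp add: Code_def case_prod_beta)
qed

lemma code_monomial_chain_code:
  assumes "fy_chain n l F a" "n \<ge> 1"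
  shows "code_monomial n (chain_code n l F a) = fy_monomial l F a"
  unfolding code_monomial_def fy_monomial_def max_letter_chain_code[OF assms]
proof (rule sum.cong)
  fix j assume "j \<in> {1..l}"
  then show "replicate_mset (snd (chain_code n l F a) j) (level_set n (fst (chain_code n l F a)) j) =
      replicate_mset (a j) (F j)"
    using level_set_chain_code[OF assms(1), of j] by (simp add: chain_code_def)
qed simp

section \<open>The chain of a code\<close>

lemma fy_chain_level_set:
  assumes "(\<alpha>, f) \<in> Code n"
  shows "fy_chain n (max_letter n \<alpha>) (level_set n \<alpha>) f"
proof -
  let ?m = "max_letter n \<alpha>"
  have occ: "2 \<le> occurrences n \<alpha> k" and f: "1 \<le> f k \<and> f k \<le> occurrences n \<alpha> k - 1"
    if "k \<in> {1..?m}" for k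
    using assms that by (auto simp: Code_def PiE_iff)
  have occurs: "{i \<in> {1..n}. \<alpha> i = k} \<noteq> {}" if "k \<in> {1..?m}" for k
  proof
    assume "{i \<in> {1..n}. \<alpha> i = k} = {}"
    with occ[OF that] show False unfolding occurrences_def by (simp only: card.empty)
  qed
  \<comment> \<open>Each of the letters 1 to \<open>?m\<close> occurs somewhere among the
    \<open>n\<close> positions, which bounds the length of the chain.\<close>
  have "card {1..?m} \<le> card (\<alpha> ` {1..n})"
    using occurs by (intro card_mono subsetI) blast+
  also have "\<dots> \<le> n"
    using card_image_le[of "{1..n}" \<alpha>] by simp
  finally have "?m \<le> n" by simp
  moreover have "level_set n \<alpha> (k - 1) \<subset> level_set n \<alpha> k" if "k \<in> {1..?m}" for k
  proof -
    have "level_set n \<alpha> k - level_set n \<alpha> (k - 1) \<noteq> {}"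
      using occurs[OF that] level_set_diff[of k n \<alpha>] that by simp
    moreover have "level_set n \<alpha> (k - 1) \<subseteq> level_set n \<alpha> k"
      by (auto simp: level_set_def)
    ultimately show ?thesis by blast
  qed
  moreover have "level_set n \<alpha> ?m \<subseteq> {1..n}" by (auto simp: level_set_def)
  moreover have "1 \<le> f k \<and>
      f k \<le> card (level_set n \<alpha> k) - card (level_set n \<alpha> (k - 1)) - 1" if "k \<in> {1..?m}" for k
    using f[OF that] that by (subst card_level_set_diff) simp_all
  ultimately show ?thesis
    unfolding fy_chain_def by (simp add: level_set_0 del: One_nat_def)
qed

text \<open>Both components are extensional, so it suffices to compare them on their domains; there
  a positive letter \<open>\<alpha> i\<close> is precisely the step at which \<open>i\<close> enters
  the level sets.\<close>

lemma chain_code_level_set: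
  assumes "(\<alpha>, f) \<in> Code n"
  shows "chain_code n (max_letter n \<alpha>) (level_set n \<alpha>) f = (\<alpha>, f)"
proof -
  let ?m = "max_letter n \<alpha>"
  note chain = fy_chain_level_set[OF assms]
  have ext: "\<alpha> \<in> extensional {1..n}" "f \<in> extensional {1..?m}"
    using assms by (auto simp: Code_def PiE_iff)
  have "fst (chain_code n ?m (level_set n \<alpha>) f) = \<alpha>"
  proof (rule extensionalityI[OF _ ext(1)])
    show "fst (chain_code n ?m (level_set n \<alpha>) f) \<in> extensional {1..n}"
      by (simp add: chain_code_def)
  next
    fix i assume i: "i \<in> {1..n}"
    have le: "\<alpha> i \<le> ?m" unfolding max_letter_def using i by (intro Max_ge) auto
    show "fst (chain_code n ?m (level_set n \<alpha>) f) i = \<alpha> i"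
    proof (cases "\<alpha> i = 0")
      case True
      then have "i \<notin> level_set n \<alpha> ?m" by (simp add: level_set_def)
      with chain_code_apply(2)[OF chain i] True show ?thesis by simp
    next
      case False
      with i have "i \<in> level_set n \<alpha> (\<alpha> i) - level_set n \<alpha> (\<alpha> i - 1)"
        by (subst level_set_diff) auto
      with le False show ?thesis by (intro chain_code_apply(1)[OF chain i]) auto
    qed
  qed
  moreover have "snd (chain_code n ?m (level_set n \<alpha>) f) = f"
    using ext(2) by (simp add: chain_code_def extensional_restrict)
  ultimately show ?thesis by (simp add: prod_eq_iff)
qed

section \<open>Bijectivity\<close>

lemma phi_code_monomial:
  assumes "c \<in> Code n"
  shows "\<phi> n (code_monomial n c) = c"
proof -
  obtain \<alpha> f where c: "c = (\<alpha>, f)" by (cases c)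
  with phi_fy_monomial[OF fy_chain_level_set] chain_code_level_set assms
  show ?thesis by (simp add: code_monomial_def)
qed

text \<open>\<open>code_monomial n\<close> is a two-sided inverse: one composition recovers the
  chain and exponents, the other the word and marks.\<close>

lemma bij_betw_phi:
  assumes "n \<ge> 1"
  shows "bij_betw (\<phi> n) (FY n) (Code n)"
proof (rule bij_betw_byWitness)
  show "\<forall>u\<in>FY n. code_monomial n (\<phi> n u) = u"
    using assms by (auto simp: FY_def phi_fy_monomial code_monomial_chain_code)
  show "\<forall>c\<in>Code n. \<phi> n (code_monomial n c) = c"
    by (simp add: phi_code_monomial)
  show "\<phi> n ` FY n \<subseteq> Code n"
    using chain_code_in_Code[OF _ assms] by (force simp: FY_def phi_fy_monomial simp del: One_nat_def)
  show "code_monomial n ` Code n \<subseteq> FY n"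
    by (force simp: FY_def code_monomial_def intro: fy_chain_level_set)
qed

section \<open>Index and symmetric group action\<close>

lemma code_ind_chain_code:
  assumes "fy_chain n l F a" "n \<ge> 1"
  shows "code_ind n (chain_code n l F a) = (\<Sum>i = 1..l. a i)"
  unfolding code_ind_def max_letter_chain_code[OF assms] by (simp add: chain_code_def)

text \<open>An injective map preserves strict inclusions and cardinalities, and a permutation of
  \<open>{1..n}\<close> keeps the chain inside the ground set.\<close>

lemma fy_chain_permutes:
  assumes "fy_chain n l F a" "\<sigma> permutes {1..n}"
  shows "fy_chain n l (\<lambda>i. \<sigma> ` F i) a"
proof -
  have inj: "inj \<sigma>" using assms(2) by (rule permutes_inj)
  then have "card (\<sigma> ` A) = card A" for A by (intro card_image inj_on_subset[OF inj]) simp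
  moreover have "\<sigma> ` A \<subset> \<sigma> ` B \<longleftrightarrow> A \<subset> B" for A B
    using inj by (simp add: psubset_eq inj_image_subset_iff inj_image_eq_iff)
  moreover have "\<sigma> ` A \<subseteq> {1..n} \<longleftrightarrow> A \<subseteq> {1..n}" for A
    using inj_image_subset_iff[OF inj, of A "{1..n}"] permutes_image[OF assms(2)] by simp
  ultimately show ?thesis using assms(1) by (simp add: fy_chain_def)
qed

lemma chain_code_permutes:
  assumes "\<sigma> permutes {1..n}"
  shows "chain_code n l (\<lambda>i. \<sigma> ` F i) a = code_act n \<sigma> (chain_code n l F a)"
proof -
  have mem: "i \<in> \<sigma> ` A \<longleftrightarrow> inv \<sigma> i \<in> A" for i A
    using bij_image_Collect_eq[OF permutes_bij[OF assms], of "\<lambda>x. x \<in> A"] by simp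
  \<comment> \<open>This matches the restrictions to \<open>{1..n}\<close>: the word on the right is
    read at \<open>inv \<sigma> i\<close>, where it must not be \<open>undefined\<close>.\<close>
  have "inv \<sigma> i \<in> {1..n} \<longleftrightarrow> i \<in> {1..n}" for i
    using permutes_in_image[OF permutes_inv[OF assms]] .
  then show ?thesis
    by (auto simp: chain_code_def code_act_def mem fun_eq_iff)
qed

theorem theorem3p6:
  fixes n :: nat
  assumes "n \<ge> 1"
  shows "bij_betw (\<phi> n) (FY n) (Code n) \<and>
         (\<forall>u\<in>FY n. fy_deg u = code_ind n (\<phi> n u)) \<and>
         (\<forall>\<sigma>. \<sigma> permutes {1..n} \<longrightarrow>
            (\<forall>u\<in>FY n. \<phi> n (fy_act \<sigma> u) = code_act n \<sigma> (\<phi> n u)))"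
proof (intro conjI allI impI ballI)
  show "bij_betw (\<phi> n) (FY n) (Code n)"
    using assms by (rule bij_betw_phi)
next
  fix u assume "u \<in> FY n"
  then show "fy_deg u = code_ind n (\<phi> n u)"
    using assms by (auto simp: FY_def phi_fy_monomial fy_deg_fy_monomial code_ind_chain_code)
next
  fix \<sigma> u assume "\<sigma> permutes {1..n}" "u \<in> FY n"
  then show "\<phi> n (fy_act \<sigma> u) = code_act n \<sigma> (\<phi> n u)"
    by (auto simp: FY_def fy_act_fy_monomial phi_fy_monomial fy_chain_permutes chain_code_permutes)
qed

end
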